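(* Let $\tau\in\mathbb{C}$. As $n\to\infty$ (i.e. for all sufficiently large integers $n$, depending on $\tau$ only), uniformly for $\alpha\in[0,\infty]$, $$C_n^{1/2-\tau-n}(\tanh\alpha)=\frac{\Omega_n(\tau)\,e^{(n+\tau)\alpha}}{\cosh^{n+\tau}\alpha}\left(D_n^{+}+D_n^{-}e^{-2(n+\tau)\alpha}+\frac{\tau(1-\tau)}{n+\tau}R_n(\alpha,\tau)\right),$$ where $$\Omega_n(\tau)=\frac{(-1)^n\,\Gamma\left(\frac12+\tau+n\right)}{\Gamma\left(\left[\frac n2\right]+1\right)\Gamma\left(\frac12+\tau+\left[\frac n2\right]\right)},\qquad D_n^{\pm}=\frac{1+(-1)^n}{4}\pm\frac{1-(-1)^n}{2n+2\tau},$$ and the function $R_n(\alpha,\tau)$ satisfies $$|R_n(\alpha,\tau)|\le\frac{2\tanh\alpha}{1-\left|\frac{\tau(1-\tau)}{n+\tau}\right|}\cdot\begin{cases}1,& n=2m,\\[2pt] \dfrac{1}{|n+\tau|},& n=2m+1,\end{cases}\qquad m\in\mathbb{N}.$$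
   Context: $C_k^{\lambda}(x)$ is the Gegenbauer polynomial $C_k^{\lambda}(x)=\sum_{j=0}^{[k/2]}\frac{(-1)^j(\lambda)_{k-j}}{j!\,(k-2j)!}(2x)^{k-2j}$, defined for all $\lambda\in\mathbb{C}$, with $(a)_n=a(a+1)\cdots(a+n-1)$; $[\cdot]$ is the integer part. At $\alpha=\infty$ the expressions are understood as limits ($\tanh\alpha=1$, $e^{(n+\tau)\alpha}/\cosh^{n+\tau}\alpha=2^{n+\tau}$). *)

theory Defs
  imports "HOL-Analysis.Analysis"
begin

definition gegenbauer :: "nat \<Rightarrow> complex \<Rightarrow> complex \<Rightarrow> complex" where
  "gegenbauer k l x =
     (\<Sum>j\<le>k div 2. (-1) ^ j * pochhammer l (k - j) / (fact j * fact (k - 2 * j)) * (2 * x) ^ (k - 2 * j))"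

(* Extension of a function on the reals to \<infinity> by its limit; the value at -\<infinity> is irrelevant. *)
definition limit_ext :: "(real \<Rightarrow> 'a::t2_space) \<Rightarrow> ereal \<Rightarrow> 'a" where
  "limit_ext f a = (if a = \<infinity> then Lim at_top f else f (real_of_ereal a))"

definition tanh_ext :: "ereal \<Rightarrow> real" where
  "tanh_ext = limit_ext tanh"

definition exp_cosh_ext :: "complex \<Rightarrow> ereal \<Rightarrow> complex" where
  "exp_cosh_ext s = limit_ext (\<lambda>a. exp (s * of_real a) / complex_of_real (cosh a) powr s)"

definition exp_decay_ext :: "complex \<Rightarrow> ereal \<Rightarrow> complex" where
  "exp_decay_ext s = limit_ext (\<lambda>a. exp (- 2 * s * of_real a))"

definition Omega :: "nat \<Rightarrow> complex \<Rightarrow> complex" where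
  "Omega n \<tau> = (-1) ^ n * Gamma (1/2 + \<tau> + of_nat n) /
     (Gamma (of_nat (n div 2) + 1) * Gamma (1/2 + \<tau> + of_nat (n div 2)))"

definition D_plus :: "nat \<Rightarrow> complex \<Rightarrow> complex" where
  "D_plus n \<tau> = (1 + (-1) ^ n) / 4 + (1 - (-1) ^ n) / (2 * of_nat n + 2 * \<tau>)"

definition D_minus :: "nat \<Rightarrow> complex \<Rightarrow> complex" where
  "D_minus n \<tau> = (1 + (-1) ^ n) / 4 - (1 - (-1) ^ n) / (2 * of_nat n + 2 * \<tau>)"

text \<open>The values at \<open>\<infinity>\<close> (the limits exist, so \<^const>\<open>Lim\<close> is meaningful in each use):\<close>

lemma tanh_ext_simps: "tanh_ext (ereal a) = tanh a" "tanh_ext \<infinity> = 1"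
  using tendsto_Lim[OF _ tanh_real_at_top]
  by (simp_all add: tanh_ext_def limit_ext_def)

lemma exp_cosh_ext_tendsto:
  "((\<lambda>a. exp (s * of_real a) / complex_of_real (cosh a) powr s) \<longlongrightarrow> 2 powr s) at_top"
proof -
  have "exp (s * of_real a) / complex_of_real (cosh a) powr s
      = complex_of_real (1 + tanh a) powr s" for a :: real
  proof -
    have c: "cosh a > 0" by simp
    have "1 + tanh a = (cosh a + sinh a) / cosh a"
      using c by (simp add: tanh_def field_simps)
    also have "cosh a + sinh a = exp a" by (rule cosh_plus_sinh)
    finally have "complex_of_real (1 + tanh a) = of_real (exp (a - ln (cosh a)))"
      using c by (simp add: exp_diff)
    then show ?thesis
      using c by (simp add: powr_def Ln_of_real exp_diff[symmetric] algebra_simps)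
  qed
  moreover have "((\<lambda>a. complex_of_real (1 + tanh a) powr s) \<longlongrightarrow> complex_of_real (1 + 1) powr s) at_top"
    by (intro tendsto_powr_complex tendsto_intros tanh_real_at_top) auto
  ultimately show ?thesis by simp
qed

lemma exp_cosh_ext_simps:
  "exp_cosh_ext s (ereal a) = exp (s * of_real a) / complex_of_real (cosh a) powr s"
  "exp_cosh_ext s \<infinity> = 2 powr s"
  using tendsto_Lim[OF _ exp_cosh_ext_tendsto[of s]]
  by (simp_all add: exp_cosh_ext_def limit_ext_def)

lemma exp_decay_ext_tendsto:
  assumes "Re s > 0"
  shows "((\<lambda>a. exp (- 2 * s * of_real a)) \<longlongrightarrow> 0) at_top"
proof (rule tendsto_norm_zero_cancel)
  have "filterlim (\<lambda>a::real. (2 * Re s) * a) at_top at_top"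
    using assms by (intro filterlim_tendsto_pos_mult_at_top[OF tendsto_const _ filterlim_ident]) auto
  then have "filterlim (\<lambda>a::real. - ((2 * Re s) * a)) at_bot at_top"
    by (simp add: filterlim_uminus_at_bot)
  then show "((\<lambda>a. norm (exp (- 2 * s * of_real a))) \<longlongrightarrow> 0) at_top"
    by (auto intro: filterlim_compose[OF exp_at_bot] simp: mult.assoc)
qed

lemma exp_decay_ext_simps:
  "exp_decay_ext s (ereal a) = exp (- 2 * s * of_real a)"
  "Re s > 0 \<Longrightarrow> exp_decay_ext s \<infinity> = 0"
  using tendsto_Lim[OF _ exp_decay_ext_tendsto[of s]]
  by (simp_all add: exp_decay_ext_def limit_ext_def)

end

theory Submission
  imports Defs
begin

text \<open>
  Write \<open>s = n + \<tau>\<close> and \<open>\<kappa> = \<tau> (1 - \<tau>)\<close>.  The polynomial \<open>y = C\<^sub>n\<^sup>\<lambda>\<close> with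
  \<open>\<lambda> = 1/2 - s\<close> solves Gegenbauer's equation
  \<open>(1 - x\<^sup>2) y'' = (2\<lambda> + 1) x y' - n (n + 2\<lambda>) y\<close>.  After the substitution \<open>x = tanh t\<close>, the function
  \<open>w t = cosh\<^sup>s t \<cdot> y (tanh t)\<close> solves \<open>w'' - s\<^sup>2 w = \<kappa> sech\<^sup>2 t \<cdot> w\<close>: the parameter \<open>\<lambda>\<close> depends on \<open>n\<close> in
  just such a way that the large parameter multiplies only \<open>w\<close> and the coefficient of the integrable
  potential \<open>sech\<^sup>2\<close> stays bounded.  So \<open>w\<close> is close to a combination of \<open>e\<^sup>s\<^sup>t\<close> and \<open>e\<^sup>-\<^sup>s\<^sup>t\<close>, and
  its initial data at \<open>t = 0\<close>, the two lowest coefficients of the polynomial, give \<open>\<Omega>\<close> and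
  \<open>D\<^sup>\<plusminus>\<close>.

  It is convenient to divide by the growing exponential: \<open>v t = e\<^sup>-\<^sup>s\<^sup>t w t\<close> solves
  \<open>v'' + 2 s v' = \<kappa> sech\<^sup>2 t \<cdot> v\<close>.  Both \<open>v' + 2 s v\<close> and \<open>e\<^sup>2\<^sup>s\<^sup>t v'\<close> would be constant for
  \<open>\<kappa> = 0\<close>, and in general their derivatives are \<open>\<kappa> sech\<^sup>2 t \<cdot> v\<close> and \<open>e\<^sup>2\<^sup>s\<^sup>t\<close> times
  that.  This bounds the distance of \<open>v\<close>
  from the unperturbed solution by \<open>\<bar>\<kappa> / s\<bar> M tanh t\<close>, where \<open>M\<close> is the maximum of \<open>\<bar>v\<bar>\<close>; the factor
  \<open>tanh t\<close> is the integral of \<open>sech\<^sup>2\<close>.  The same bound at the point where \<open>\<bar>v\<bar>\<close> is maximal estimates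
  \<open>M\<close> itself, which is where the denominator \<open>1 - \<bar>\<kappa> / s\<bar>\<close> comes from
  (\<open>perturbed_damped_ode_bound\<close>).  Since the bound is uniform in \<open>t\<close>, it passes to the limit
  \<open>t \<rightarrow> \<infinity>\<close>.
\<close>

section \<open>Perturbation of a damped linear equation\<close>

text \<open>
  The functions \<open>P = v' + 2 s v\<close> and \<open>Q = e\<^sup>2\<^sup>s\<^sup>t v'\<close> are first integrals of the equation with
  \<open>\<kappa> = 0\<close>, whose solution with the same initial data is \<open>v0\<close>; and \<open>2 s v = P - e\<^sup>-\<^sup>2\<^sup>s\<^sup>t Q\<close>.  Comparing
  their derivatives with that of \<open>g\<close> bounds \<open>v - v0\<close> by means of the maximum of \<open>\<bar>v\<bar>\<close>, and
  the bound at a maximum point closes the argument.  Working with \<open>P\<close> and \<open>Q\<close> replaces the Volterra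
  integral equation for \<open>v\<close>.
\<close>

lemma perturbed_damped_ode_bound:
  fixes v v' :: "real \<Rightarrow> complex" and g g' :: "real \<Rightarrow> real" and s \<kappa> :: complex
  defines "v0 \<equiv> \<lambda>t. v 0 + v' 0 / (2 * s) * (1 - exp (- 2 * s * of_real t))"
  assumes v: "\<And>t. t \<ge> 0 \<Longrightarrow> (v has_vector_derivative v' t) (at t)"
    and v': "\<And>t. t \<ge> 0 \<Longrightarrow> (v' has_vector_derivative \<kappa> * of_real (g' t) * v t - 2 * s * v' t) (at t)"
    and g: "\<And>t. t \<ge> 0 \<Longrightarrow> (g has_vector_derivative g' t) (at t)"
    and g0: "g 0 = 0" and g'_nonneg: "\<And>t. t \<ge> 0 \<Longrightarrow> g' t \<ge> 0"
    and g_le: "\<And>t. t \<ge> 0 \<Longrightarrow> g t \<le> 1"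
    and s: "Re s > 0" and small: "norm (\<kappa> / s) < 1"
    and B: "\<And>t. t \<ge> 0 \<Longrightarrow> norm (v0 t) \<le> B"
    and a: "a \<ge> 0"
  shows "norm (v a - v0 a) \<le> norm (\<kappa> / s) * (B / (1 - norm (\<kappa> / s))) * g a"
proof -
  have s0: "s \<noteq> 0" using s by auto
  define e where "e = (\<lambda>t::real. exp (2 * s * of_real t))"
  define P where "P = (\<lambda>t. v' t + 2 * s * v t)"
  define Q where "Q = (\<lambda>t. v' t * e t)"
  have e': "(e has_vector_derivative 2 * s * e t) (at t)" for t
    unfolding e_def
    by (auto intro!: derivative_eq_intros has_vector_derivative_real_field)
  have P': "(P has_vector_derivative \<kappa> * of_real (g' t) * v t) (at t)" if "t \<ge> 0" for t
    unfolding P_def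
    by (rule has_vector_derivative_eq_rhs,
        (rule has_vector_derivative_add v' v has_vector_derivative_mult_right that)+) simp
  have Q': "(Q has_vector_derivative \<kappa> * of_real (g' t) * v t * e t) (at t)" if "t \<ge> 0" for t
    unfolding Q_def
    by (rule has_vector_derivative_eq_rhs,
        (rule has_vector_derivative_mult v' e' that)+) (simp add: algebra_simps)
  have g_nonneg: "g b \<ge> 0" if "b \<ge> 0" for b
  proof (cases "b = 0")
    case False
    have "g 0 \<le> g b"
    proof (rule DERIV_nonneg_imp_nondecreasing[of 0 b g])
      fix x :: real assume "0 \<le> x"
      then show "\<exists>y. (g has_real_derivative y) (at x) \<and> 0 \<le> y"
        using g g'_nonneg has_real_derivative_iff_has_vector_derivative by blast
    qed (use that in auto)
    then show ?thesis using g0 by simp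
  qed (simp add: g0)
  \<comment> \<open>The comparison with any bound \<open>M\<close> of \<open>\<bar>v\<bar>\<close>; each of \<open>P\<close> and \<open>Q\<close> contributes \<open>\<bar>\<kappa>\<bar> M g b\<close>,
      which cancels the factor 2 in \<open>2 s (v - v0)\<close>.\<close>
  have key: "norm (v b - v0 b) \<le> norm (\<kappa> / s) * M * g b"
    if b: "b \<ge> 0" and M: "\<And>t. 0 \<le> t \<Longrightarrow> t \<le> b \<Longrightarrow> norm (v t) \<le> M" for b M
  proof (cases "b = 0")
    case True
    then show ?thesis by (simp add: v0_def g0)
  next
    case False
    with b have b: "0 < b" by simp
    have gM: "norm (\<kappa> * of_real (g' t) * v t) \<le> norm \<kappa> * M * g' t" if "0 \<le> t" "t \<le> b" for t
      using mult_left_mono[OF M[OF that], of "norm \<kappa> * g' t"] g'_nonneg[OF that(1)]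
      by (simp add: norm_mult algebra_simps)
    have deriv_g: "((\<lambda>t. c * g t) has_vector_derivative c * g' t) (at t)" if "0 \<le> t" for t c
      by (rule has_vector_derivative_mult_right[OF g[OF that]])
    have "norm (P b - P 0) \<le> norm \<kappa> * M * g b - norm \<kappa> * M * g 0"
      by (rule differentiable_bound_general[OF b,
            where f' = "\<lambda>t. \<kappa> * of_real (g' t) * v t" and \<phi>' = "\<lambda>t. norm \<kappa> * M * g' t"])
        (auto intro!: P' deriv_g gM continuous_at_imp_continuous_on
          intro: P'[THEN has_vector_derivative_continuous]
            deriv_g[THEN has_vector_derivative_continuous])
    then have Pb: "norm (P b - P 0) \<le> norm \<kappa> * M * g b"
      using g0 by simp
    \<comment> \<open>The growth of \<open>Q\<close> up to \<open>b\<close> is cancelled by the factor \<open>e\<^sup>-\<^sup>2\<^sup>s\<^sup>b\<close> because \<open>Re s > 0\<close>.\<close>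
    define E where "E = exp (2 * Re s * b)"
    have eE: "norm (e t) \<le> E" if "t \<le> b" for t
      using s that by (simp add: e_def E_def)
    have "norm (Q b - Q 0) \<le> E * norm \<kappa> * M * g b - E * norm \<kappa> * M * g 0"
    proof (rule differentiable_bound_general[OF b,
            where f' = "\<lambda>t. \<kappa> * of_real (g' t) * v t * e t" and \<phi>' = "\<lambda>t. E * norm \<kappa> * M * g' t"])
      fix t assume t: "0 < t" "t < b"
      have "norm (\<kappa> * of_real (g' t) * v t) * norm (e t) \<le> (norm \<kappa> * M * g' t) * E"
        by (rule mult_mono[OF gM eE]) (use t gM[of t] in \<open>auto intro: order_trans[OF norm_ge_zero]\<close>)
      then show "norm (\<kappa> * of_real (g' t) * v t * e t) \<le> E * norm \<kappa> * M * g' t"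
        by (simp add: norm_mult algebra_simps)
    qed (auto intro!: Q' deriv_g continuous_at_imp_continuous_on
          intro: Q'[THEN has_vector_derivative_continuous]
            deriv_g[THEN has_vector_derivative_continuous])
    then have Qb: "norm (Q b - Q 0) \<le> E * (norm \<kappa> * M * g b)"
      using g0 by (simp add: algebra_simps)
    have "exp (- 2 * s * of_real b) * e b = 1"
      by (simp add: e_def flip: exp_add)
    then have "exp (- 2 * s * of_real b) * (Q b - Q 0) = v' b - exp (- 2 * s * of_real b) * v' 0"
      by (simp add: Q_def e_def algebra_simps)
    moreover have "2 * s * (v b - v0 b) = 2 * s * (v b - v 0) - v' 0 * (1 - exp (- 2 * s * of_real b))"
      using s0 by (simp add: v0_def field_simps)
    ultimately have eq: "2 * s * (v b - v0 b) = (P b - P 0) - exp (- 2 * s * of_real b) * (Q b - Q 0)"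
      by (simp only: P_def) (simp add: algebra_simps)
    have "norm (exp (- 2 * s * of_real b)) * norm (Q b - Q 0)
        \<le> exp (- 2 * Re s * b) * (E * (norm \<kappa> * M * g b))"
      using Qb by (simp add: mult_left_mono)
    also have "\<dots> = norm \<kappa> * M * g b"
      by (simp add: E_def exp_minus)
    finally have "norm (2 * s * (v b - v0 b)) \<le> norm \<kappa> * M * g b + norm \<kappa> * M * g b"
      unfolding eq using Pb norm_triangle_ineq4[of "P b - P 0" "exp (- 2 * s * of_real b) * (Q b - Q 0)"]
      unfolding norm_mult by linarith
    then have "norm s * norm (v b - v0 b) \<le> norm \<kappa> * M * g b"
      unfolding norm_mult by (simp add: mult_ac)
    then show ?thesis using s0
      by (simp add: norm_divide pos_le_divide_eq mult_ac)
  qed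
  have "continuous_on {0..a} (\<lambda>t. norm (v t))"
    by (intro continuous_on_norm continuous_at_imp_continuous_on ballI
        has_vector_derivative_continuous[OF v]) auto
  then obtain c where c: "0 \<le> c" "c \<le> a" and max: "\<And>t. 0 \<le> t \<Longrightarrow> t \<le> a \<Longrightarrow> norm (v t) \<le> norm (v c)"
    using continuous_attains_sup[of "{0..a}" "\<lambda>t. norm (v t)"] a by (auto simp: compact_Icc)
  have "norm (v c) \<le> norm (v0 c) + norm (v c - v0 c)"
    by (metis add.commute diff_add_cancel norm_triangle_ineq)
  also have "\<dots> \<le> B + norm (\<kappa> / s) * norm (v c) * g c"
    using c max by (intro add_mono B key) auto
  also have "\<dots> \<le> B + norm (\<kappa> / s) * norm (v c) * 1"
    using c g_le by (intro add_left_mono mult_left_mono) auto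
  finally have "norm (v c) \<le> B / (1 - norm (\<kappa> / s))"
    using small by (simp add: field_simps)
  then have "norm (\<kappa> / s) * norm (v c) * g a \<le> norm (\<kappa> / s) * (B / (1 - norm (\<kappa> / s))) * g a"
    by (intro mult_right_mono mult_left_mono g_nonneg a) auto
  moreover have "norm (v a - v0 a) \<le> norm (\<kappa> / s) * norm (v c) * g a"
    by (rule key[OF a max])
  ultimately show ?thesis by (rule order_trans[rotated])
qed

section \<open>Gegenbauer's differential equation\<close>

definition gegenbauer_poly :: "nat \<Rightarrow> complex \<Rightarrow> complex poly" where
  "gegenbauer_poly n l = (\<Sum>j\<le>n div 2.
     monom ((-1) ^ j * pochhammer l (n - j) * 2 ^ (n - 2 * j) / (fact j * fact (n - 2 * j))) (n - 2 * j))"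

lemma poly_gegenbauer_poly: "poly (gegenbauer_poly n l) x = gegenbauer n l x"
  by (simp add: gegenbauer_poly_def gegenbauer_def poly_sum poly_monom power_mult_distrib mult_ac)

lemma coeff_gegenbauer_poly:
  assumes "n = k + 2 * j"
  shows "coeff (gegenbauer_poly n l) k =
    (-1) ^ j * pochhammer l (k + j) * 2 ^ k / (fact j * fact k)"
proof -
  have "coeff (gegenbauer_poly n l) k = (\<Sum>i\<le>n div 2. if i = j then
     (-1) ^ i * pochhammer l (n - i) * 2 ^ (n - 2 * i) / (fact i * fact (n - 2 * i)) else 0)"
    unfolding gegenbauer_poly_def coeff_sum using assms
    by (intro sum.cong) auto
  also have "\<dots> = (-1) ^ j * pochhammer l (k + j) * 2 ^ k / (fact j * fact k)"
    using assms by (simp add: sum.delta mult_2)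
  finally show ?thesis .
qed

lemma coeff_gegenbauer_poly_eq_0:
  assumes "\<And>j. n \<noteq> k + 2 * j"
  shows "coeff (gegenbauer_poly n l) k = 0"
proof -
  have "n - 2 * i \<noteq> k" if "i \<le> n div 2" for i
    using assms[of i] that by auto
  then show ?thesis
    by (auto simp: gegenbauer_poly_def coeff_sum intro!: sum.neutral)
qed

text \<open>
  This is Gegenbauer's differential equation read off coefficient by coefficient.
\<close>

lemma coeff_gegenbauer_poly_rec:
  "of_nat ((k + 1) * (k + 2)) * coeff (gegenbauer_poly n l) (k + 2) =
     (of_nat k - of_nat n) * (of_nat k + of_nat n + 2 * l) * coeff (gegenbauer_poly n l) k"
proof (cases "\<exists>j. n = k + 2 * j")
  case True
  then obtain j where j: "n = k + 2 * j" by auto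
  show ?thesis
  proof (cases j)
    case 0
    then have "coeff (gegenbauer_poly n l) (k + 2) = 0"
      using j by (intro coeff_gegenbauer_poly_eq_0) auto
    then show ?thesis using j 0 by simp
  next
    case (Suc i)
    then have n2: "n = (k + 2) + 2 * i" using j by simp
    have poch: "pochhammer l (Suc (Suc (k + i))) = pochhammer l (Suc (k + i)) * (l + of_nat (Suc (k + i)))"
      by (rule pochhammer_Suc)
    define A where "A = (-1) ^ i * pochhammer l (Suc (k + i)) * 2 ^ k / (fact i * fact k)"
    have ne: "of_nat k + 1 \<noteq> (0::complex)" "of_nat k + 2 \<noteq> (0::complex)" "of_nat i + 1 \<noteq> (0::complex)"
      using of_nat_neq_0[where 'a=complex, of k] of_nat_neq_0[where 'a=complex, of "Suc k"]
        of_nat_neq_0[where 'a=complex, of i]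
      by (simp_all add: add_ac)
    have "coeff (gegenbauer_poly n l) (k + 2) =
        (-1) ^ i * (pochhammer l (Suc (k + i)) * (l + of_nat (Suc (k + i)))) * (4 * 2 ^ k) /
          (fact i * ((of_nat k + 2) * ((of_nat k + 1) * fact k)))"
      using coeff_gegenbauer_poly[OF n2, of l] poch by (simp add: add_ac)
    then have 1: "of_nat ((k + 1) * (k + 2)) * coeff (gegenbauer_poly n l) (k + 2) = 4 * A * (l + of_nat (Suc (k + i)))"
      using ne by (simp add: A_def divide_simps add_ac) (simp add: algebra_simps)
    have "coeff (gegenbauer_poly n l) k =
        - ((-1) ^ i * pochhammer l (Suc (k + i)) * 2 ^ k / ((of_nat i + 1) * fact i * fact k))"
      using coeff_gegenbauer_poly[OF j, of l] Suc by (simp add: add_ac)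
    then have 2: "(of_nat i + 1) * coeff (gegenbauer_poly n l) k = - A"
      using ne by (simp add: A_def divide_simps add_ac) (simp add: mult_ac)
    have "(of_nat k - of_nat n) * (of_nat k + of_nat n + 2 * l) * coeff (gegenbauer_poly n l) k =
        - 4 * (l + of_nat (Suc (k + i))) * ((of_nat i + 1) * coeff (gegenbauer_poly n l) k)"
      unfolding n2 by (simp add: algebra_simps)
    then show ?thesis unfolding 1 2 by (simp add: algebra_simps)
  qed
next
  case False
  then have "coeff (gegenbauer_poly n l) k = 0"
    by (intro coeff_gegenbauer_poly_eq_0) auto
  moreover have "coeff (gegenbauer_poly n l) (k + 2) = 0"
    using False by (intro coeff_gegenbauer_poly_eq_0) (metis add.assoc mult_Suc_right)
  ultimately show ?thesis by simp
qed

lemma gegenbauer_poly_ode: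
  fixes n :: nat and x l :: complex
  defines "p \<equiv> gegenbauer_poly n l"
  shows "(1 - x\<^sup>2) * poly (pderiv (pderiv p)) x =
    (2 * l + 1) * x * poly (pderiv p) x - of_nat n * (of_nat n + 2 * l) * poly p x"
proof -
  have "pderiv (pderiv p) - pCons 0 (pCons 0 (pderiv (pderiv p))) =
    smult (2 * l + 1) (pCons 0 (pderiv p)) - smult (of_nat n * (of_nat n + 2 * l)) p"
  proof (rule poly_eqI)
    fix k
    have rec: "of_nat ((k + 1) * (k + 2)) * coeff p (k + 2) =
       (of_nat k - of_nat n) * (of_nat k + of_nat n + 2 * l) * coeff p k"
      unfolding p_def by (rule coeff_gegenbauer_poly_rec)
    consider "k = 0" | "k = 1" | i where "k = i + 2"
      by (metis One_nat_def add_2_eq_Suc' not0_implies_Suc)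
    then show "coeff (pderiv (pderiv p) - pCons 0 (pCons 0 (pderiv (pderiv p)))) k =
      coeff (smult (2 * l + 1) (pCons 0 (pderiv p)) - smult (of_nat n * (of_nat n + 2 * l)) p) k"
      using rec by cases (simp_all add: coeff_pderiv numeral_eq_Suc algebra_simps)
  qed
  then have "poly (pderiv (pderiv p) - pCons 0 (pCons 0 (pderiv (pderiv p)))) x =
    poly (smult (2 * l + 1) (pCons 0 (pderiv p)) - smult (of_nat n * (of_nat n + 2 * l)) p) x"
    by simp
  then show ?thesis by (simp add: power2_eq_square algebra_simps)
qed

lemma gegenbauer_poly_lowest_even:
  "coeff (gegenbauer_poly (2 * m) l) 0 = (-1) ^ m * pochhammer l m / fact m"
  "coeff (gegenbauer_poly (2 * m) l) 1 = 0"
  using coeff_gegenbauer_poly[of "2 * m" 0 m l]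
  by (simp, intro coeff_gegenbauer_poly_eq_0) presburger

lemma gegenbauer_poly_lowest_odd:
  "coeff (gegenbauer_poly (2 * m + 1) l) 0 = 0"
  "coeff (gegenbauer_poly (2 * m + 1) l) 1 = 2 * ((-1) ^ m * pochhammer l (m + 1) / fact m)"
proof -
  show "coeff (gegenbauer_poly (2 * m + 1) l) 0 = 0"
    by (intro coeff_gegenbauer_poly_eq_0) presburger
  have "coeff (gegenbauer_poly (2 * m + 1) l) 1 =
      (-1) ^ m * pochhammer l (1 + m) * 2 ^ 1 / (fact m * fact 1)"
    by (rule coeff_gegenbauer_poly) simp
  also have "\<dots> = 2 * ((-1) ^ m * pochhammer l (m + 1) / fact m)"
    by simp
  finally show "coeff (gegenbauer_poly (2 * m + 1) l) 1 = \<dots>" .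
qed

section \<open>The equation after the substitution by tanh\<close>

text \<open>
  The exponential factor is \<open>e\<^sup>-\<^sup>s\<^sup>t cosh\<^sup>s t\<close>, written without a complex power so that it can be
  differentiated directly.
\<close>

definition normalized_gegenbauer :: "nat \<Rightarrow> complex \<Rightarrow> real \<Rightarrow> complex" where
  "normalized_gegenbauer n s t =
     gegenbauer n (1/2 - s) (of_real (tanh t)) * exp (s * of_real (ln (cosh t) - t))"

definition normalized_gegenbauer_deriv :: "nat \<Rightarrow> complex \<Rightarrow> real \<Rightarrow> complex" where
  "normalized_gegenbauer_deriv n s t =
     (let p = gegenbauer_poly n (1/2 - s); x = of_real (tanh t) in
       ((1 - x\<^sup>2) * poly (pderiv p) x + s * (x - 1) * poly p x) * exp (s * of_real (ln (cosh t) - t)))"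

lemma has_vector_derivative_poly_tanh:
  fixes p :: "complex poly"
  defines "x \<equiv> \<lambda>t. complex_of_real (tanh t)"
  shows "((\<lambda>t. poly p (x t)) has_vector_derivative (1 - (x t)\<^sup>2) * poly (pderiv p) (x t)) (at t)"
proof -
  have "(tanh has_real_derivative 1 - (tanh t)\<^sup>2) (at t)"
    by (auto intro!: derivative_eq_intros)
  then have "(x has_vector_derivative of_real (1 - (tanh t)\<^sup>2)) (at t)"
    unfolding x_def by (rule has_vector_derivative_of_real)
  then have "((poly p \<circ> x) has_vector_derivative of_real (1 - (tanh t)\<^sup>2) * poly (pderiv p) (x t)) (at t)"
    by (rule field_vector_diff_chain_at) (rule poly_DERIV)
  then show ?thesis by (simp add: o_def x_def)
qed

lemma has_vector_derivative_exp_ln_cosh: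
  "((\<lambda>t. exp (s * complex_of_real (ln (cosh t) - t))) has_vector_derivative
     s * (of_real (tanh t) - 1) * exp (s * of_real (ln (cosh t) - t))) (at t)"
proof -
  have "((\<lambda>t. ln (cosh t) - t) has_real_derivative tanh t - 1) (at t)"
    by (auto intro!: derivative_eq_intros simp: tanh_def)
  then have 1: "((\<lambda>t. complex_of_real (ln (cosh t) - t)) has_vector_derivative of_real (tanh t - 1)) (at t)"
    by (rule has_vector_derivative_of_real)
  have 2: "((\<lambda>z. exp (s * z)) has_field_derivative s * exp (s * z)) (at z)" for z
    by (auto intro!: derivative_eq_intros)
  from field_vector_diff_chain_at[OF 1 2] show ?thesis by (simp add: o_def mult_ac)
qed

lemma has_vector_derivative_normalized_gegenbauer:
  "(normalized_gegenbauer n s has_vector_derivative normalized_gegenbauer_deriv n s t) (at t)"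
  unfolding normalized_gegenbauer_def normalized_gegenbauer_deriv_def Let_def
    poly_gegenbauer_poly[symmetric]
  by (rule has_vector_derivative_eq_rhs,
      (rule has_vector_derivative_mult has_vector_derivative_poly_tanh
        has_vector_derivative_exp_ln_cosh)+) (simp add: algebra_simps)

text \<open>
  The coefficient \<open>\<tau> (1 - \<tau>)\<close> arises as \<open>s - s\<^sup>2 - n (n + 1 - 2 s)\<close> with \<open>s = n + \<tau>\<close>: the terms that
  are quadratic and linear in \<open>n\<close> cancel.
\<close>

lemma has_vector_derivative_normalized_gegenbauer_deriv:
  fixes n :: nat and \<tau> :: complex
  defines "s \<equiv> of_nat n + \<tau>"
  shows "(normalized_gegenbauer_deriv n s has_vector_derivative
     \<tau> * (1 - \<tau>) * of_real (1 - (tanh t)\<^sup>2) * normalized_gegenbauer n s t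
       - 2 * s * normalized_gegenbauer_deriv n s t) (at t)"
proof -
  define p where "p = gegenbauer_poly n (1/2 - s)"
  define x where "x = (\<lambda>t. complex_of_real (tanh t))"
  define h where "h = (\<lambda>t. exp (s * complex_of_real (ln (cosh t) - t)))"
  \<comment> \<open>The derivative is again a polynomial in \<open>tanh t\<close> times \<open>h\<close>, so one differentiation rule serves twice.\<close>
  define q where "q = [:1, 0, -1:] * pderiv p + smult s ([:-1, 1:] * p)"
  have "poly (pderiv q) (x t) = (1 - (x t)\<^sup>2) * poly (pderiv (pderiv p)) (x t)
      - 2 * x t * poly (pderiv p) (x t) + s * poly p (x t) + s * (x t - 1) * poly (pderiv p) (x t)"
    unfolding q_def by (simp add: pderiv_add pderiv_diff pderiv_minus pderiv_mult pderiv_smult pderiv_pCons power2_eq_square algebra_simps)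
  also have "\<dots> = (- 2 * s * x t + s * (x t - 1)) * poly (pderiv p) (x t)
      + (s - of_nat n * (of_nat n + 1 - 2 * s)) * poly p (x t)"
    unfolding p_def gegenbauer_poly_ode by (simp add: algebra_simps)
  finally have q': "poly (pderiv q) (x t) = \<dots>" .
  have q: "poly q (x t) = (1 - (x t)\<^sup>2) * poly (pderiv p) (x t) + s * (x t - 1) * poly p (x t)" for t
    by (simp add: q_def power2_eq_square algebra_simps)
  have v': "normalized_gegenbauer_deriv n s = (\<lambda>t. poly q (x t) * h t)"
    unfolding normalized_gegenbauer_deriv_def Let_def q
    unfolding h_def p_def x_def by (rule refl)
  have v: "normalized_gegenbauer n s t = poly p (x t) * h t"
    by (simp add: normalized_gegenbauer_def poly_gegenbauer_poly h_def p_def x_def)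
  have "((\<lambda>t. poly q (x t) * h t) has_vector_derivative
      poly q (x t) * (s * (x t - 1) * h t) + (1 - (x t)\<^sup>2) * poly (pderiv q) (x t) * h t) (at t)"
    unfolding x_def h_def
    by (intro has_vector_derivative_mult has_vector_derivative_poly_tanh has_vector_derivative_exp_ln_cosh)
  moreover have "poly q (x t) * (s * (x t - 1) * h t) + (1 - (x t)\<^sup>2) * poly (pderiv q) (x t) * h t =
      \<tau> * (1 - \<tau>) * (1 - (x t)\<^sup>2) * (poly p (x t) * h t) - 2 * s * (poly q (x t) * h t)"
  proof -
    have \<tau>: "\<tau> = s - of_nat n" by (simp add: s_def)
    show ?thesis unfolding q' q \<tau> by algebra
  qed
  ultimately show ?thesis
    unfolding v v' by (simp add: x_def)
qed

section \<open>Initial values and the unperturbed solution\<close>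

lemma Re_pos_not_nonpos_Int: "Re z > 0 \<Longrightarrow> z \<notin> \<int>\<^sub>\<le>\<^sub>0"
  by (auto elim!: nonpos_Ints_cases)

text \<open>
  The Pochhammer symbol runs through negative half-shifted arguments; reflecting it turns it into a
  quotient of Gamma values.  The positive real part keeps the arguments away from the poles.
\<close>

lemma Omega_even:
  assumes "Re (1/2 + \<tau> + of_nat m) > 0"
  shows "(-1) ^ m * pochhammer (1/2 - \<tau> - of_nat (2 * m)) m / fact m = Omega (2 * m) \<tau>"
proof -
  note nz = Re_pos_not_nonpos_Int[OF assms]
  have "pochhammer (1/2 - \<tau> - of_nat (2 * m)) m = (-1) ^ m * pochhammer (1/2 + \<tau> + of_nat m) m"
    using pochhammer_minus[of "\<tau> + of_nat (2 * m) - 1/2" m] by (simp add: algebra_simps)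
  also have "pochhammer (1/2 + \<tau> + of_nat m) m =
      Gamma (1/2 + \<tau> + of_nat (2 * m)) / Gamma (1/2 + \<tau> + of_nat m)"
    using pochhammer_Gamma[OF nz, of m] by (simp add: algebra_simps)
  finally show ?thesis
    using Gamma_fact[of m, where 'a=complex]
    by (simp add: Omega_def add.commute flip: power_mult_distrib)
qed

lemma Omega_odd:
  assumes "Re (1/2 + \<tau> + of_nat m) > 0"
  shows "(-1) ^ m * pochhammer (1/2 - \<tau> - of_nat (2 * m + 1)) (m + 1) / fact m = Omega (2 * m + 1) \<tau>"
proof -
  note nz = Re_pos_not_nonpos_Int[OF assms]
  have "pochhammer (1/2 - \<tau> - of_nat (2 * m + 1)) (m + 1)
      = (-1) ^ (m + 1) * pochhammer (1/2 + \<tau> + of_nat m) (m + 1)"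
    using pochhammer_minus[of "\<tau> + of_nat (2 * m + 1) - 1/2" "m + 1"] by (simp add: algebra_simps)
  also have "pochhammer (1/2 + \<tau> + of_nat m) (m + 1) =
      Gamma (1/2 + \<tau> + of_nat (2 * m + 1)) / Gamma (1/2 + \<tau> + of_nat m)"
    using pochhammer_Gamma[OF nz, of "m + 1"] by (simp add: algebra_simps)
  finally show ?thesis
    using Gamma_fact[of m, where 'a=complex]
    by (simp add: Omega_def add.commute flip: power_mult_distrib)
qed

text \<open>
  The left-hand side, with \<open>e = e\<^sup>-\<^sup>2\<^sup>s\<^sup>t\<close>, is the solution of \<open>v'' + 2 s v' = 0\<close> that has the initial
  data of the normalized polynomial.
\<close>

lemma normalized_gegenbauer_initial:
  fixes n :: nat and \<tau> :: complex
  defines "s \<equiv> of_nat n + \<tau>"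
  assumes pos: "Re (1/2 + \<tau> + of_nat (n div 2)) > 0" and s: "s \<noteq> 0"
  shows "normalized_gegenbauer n s 0 + normalized_gegenbauer_deriv n s 0 / (2 * s) * (1 - e) =
    Omega n \<tau> * (D_plus n \<tau> + D_minus n \<tau> * e)"
proof -
  define p where "p = gegenbauer_poly n (1/2 - s)"
  have l: "1/2 - s = 1/2 - \<tau> - of_nat n" by (simp add: s_def)
  have v: "normalized_gegenbauer n s 0 = coeff p 0"
    by (simp add: normalized_gegenbauer_def p_def poly_0_coeff_0 flip: poly_gegenbauer_poly)
  have v': "normalized_gegenbauer_deriv n s 0 = coeff p 1 - s * coeff p 0"
    by (simp add: normalized_gegenbauer_deriv_def p_def poly_0_coeff_0 coeff_pderiv Let_def)
  have s2: "2 * of_nat n + 2 * \<tau> = 2 * s" by (simp add: s_def)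
  show ?thesis
  proof (cases "even n")
    case True
    then obtain m where m: "n = 2 * m" by (elim evenE)
    have "coeff p 0 = Omega n \<tau>" "coeff p 1 = 0"
      using gegenbauer_poly_lowest_even[of m "1/2 - s"] Omega_even[of \<tau> m] pos
      by (simp_all add: p_def m l)
    then show ?thesis
      using s True unfolding v v' D_plus_def D_minus_def s2 by (simp add: field_simps)
  next
    case False
    then obtain m where m: "n = 2 * m + 1" by (elim oddE)
    have odd_div: "(2 * m + 1) div 2 = m" by simp
    have "coeff p 0 = 0" "coeff p 1 = 2 * Omega n \<tau>"
      using gegenbauer_poly_lowest_odd[of m "1/2 - s"] Omega_odd[of \<tau> m] pos
      unfolding p_def l by (simp_all only: m) (simp_all only: odd_div)
    then show ?thesis
      using s False unfolding v v' D_plus_def D_minus_def s2 by (simp add: field_simps)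
  qed
qed

lemma norm_leading_factor_le:
  fixes n :: nat and \<tau> e :: complex
  assumes "norm e \<le> 1"
  shows "norm (D_plus n \<tau> + D_minus n \<tau> * e) \<le> 2 * (if even n then 1 else 1 / norm (of_nat n + \<tau>))"
proof -
  define s where "s = of_nat n + \<tau>"
  have s2: "2 * of_nat n + 2 * \<tau> = 2 * s" by (simp add: s_def)
  have e: "norm (1 + e) \<le> 2" "norm (1 - e) \<le> 2"
    using norm_triangle_ineq[of 1 e] norm_triangle_ineq4[of 1 e] assms by auto
  show ?thesis
  proof (cases "even n")
    case True
    then have eq: "D_plus n \<tau> + D_minus n \<tau> * e = (1 + e) / 2"
      by (simp add: D_plus_def D_minus_def add_divide_distrib)
    show ?thesis unfolding eq using True e by (simp add: norm_divide)
  next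
    case False
    then have eq: "D_plus n \<tau> + D_minus n \<tau> * e = (1 - e) / s"
      unfolding D_plus_def D_minus_def s2 by (simp add: diff_divide_distrib)
    show ?thesis
      unfolding eq using False e by (simp add: norm_divide divide_right_mono flip: s_def)
  qed
qed

section \<open>The remainder estimate\<close>

lemma normalized_gegenbauer_estimate:
  fixes n :: nat and \<tau> :: complex and a :: real
  defines "s \<equiv> of_nat n + \<tau>"
  assumes pos: "Re (1/2 + \<tau> + of_nat (n div 2)) > 0" and s: "Re s > 0"
    and small: "norm (\<tau> * (1 - \<tau>) / s) < 1" and a: "a \<ge> 0"
  shows "norm (normalized_gegenbauer n s a
        - Omega n \<tau> * (D_plus n \<tau> + D_minus n \<tau> * exp (- 2 * s * of_real a)))
    \<le> norm (Omega n \<tau>) * norm (\<tau> * (1 - \<tau>) / s) *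
      (2 * tanh a / (1 - norm (\<tau> * (1 - \<tau>) / s)) * (if even n then 1 else 1 / norm s))"
proof -
  let ?v = "normalized_gegenbauer n s" and ?v' = "normalized_gegenbauer_deriv n s"
  define B where "B = norm (Omega n \<tau>) * (2 * (if even n then 1 else 1 / norm s))"
  have init: "?v 0 + ?v' 0 / (2 * s) * (1 - e) = Omega n \<tau> * (D_plus n \<tau> + D_minus n \<tau> * e)" for e
    using normalized_gegenbauer_initial[of \<tau> n e] pos s unfolding s_def by fastforce
  have "norm (?v a - (?v 0 + ?v' 0 / (2 * s) * (1 - exp (- 2 * s * of_real a))))
    \<le> norm (\<tau> * (1 - \<tau>) / s) * (B / (1 - norm (\<tau> * (1 - \<tau>) / s))) * tanh a"
  proof (rule perturbed_damped_ode_bound[where g' = "\<lambda>t. 1 - (tanh t)\<^sup>2"])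
    show "(?v has_vector_derivative ?v' t) (at t)" for t
      by (rule has_vector_derivative_normalized_gegenbauer)
    show "(?v' has_vector_derivative \<tau> * (1 - \<tau>) * of_real (1 - (tanh t)\<^sup>2) * ?v t - 2 * s * ?v' t) (at t)" for t
      unfolding s_def by (rule has_vector_derivative_normalized_gegenbauer_deriv)
    show "(tanh has_vector_derivative 1 - (tanh t)\<^sup>2) (at t)" for t :: real
      by (auto intro!: derivative_eq_intros simp flip: has_real_derivative_iff_has_vector_derivative)
    show "0 \<le> 1 - (tanh t)\<^sup>2" for t :: real
      using tanh_real_bounds[of t] by (simp add: abs_square_le_1 abs_le_iff)
    show "tanh t \<le> 1" for t :: real
      using tanh_real_lt_1[of t] by simp
    show "norm (?v 0 + ?v' 0 / (2 * s) * (1 - exp (- 2 * s * of_real t))) \<le> B" if "t \<ge> 0" for t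
      unfolding init B_def norm_mult
      by (intro mult_left_mono norm_leading_factor_le[of _ n \<tau>, folded s_def]) (use s that in auto)
  qed (use s small a in auto)
  then show ?thesis unfolding init B_def by (simp add: mult_ac)
qed

lemma gegenbauer_tanh_ext_eq:
  "gegenbauer n (1/2 - s) (of_real (tanh_ext (ereal a))) = exp_cosh_ext s (ereal a) * normalized_gegenbauer n s a"
proof -
  have "exp_cosh_ext s (ereal a) * exp (s * of_real (ln (cosh a) - a)) = 1"
    using cosh_real_pos[of a]
    by (simp add: exp_cosh_ext_simps powr_def Ln_of_real algebra_simps exp_diff)
  then show ?thesis by (simp add: normalized_gegenbauer_def tanh_ext_simps)
qed

lemma exp_cosh_ext_nonzero: "a \<noteq> -\<infinity> \<Longrightarrow> exp_cosh_ext s a \<noteq> 0"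
  by (cases a) (simp_all add: exp_cosh_ext_simps)

text \<open>
  Both sides are continuous at infinity, so the estimate for finite arguments survives in the limit.
\<close>

lemma gegenbauer_estimate_ext:
  fixes n :: nat and \<tau> :: complex and \<alpha> :: ereal
  defines "s \<equiv> of_nat n + \<tau>"
  assumes pos: "Re (1/2 + \<tau> + of_nat (n div 2)) > 0" and s: "Re s > 0"
    and small: "norm (\<tau> * (1 - \<tau>) / s) < 1" and \<alpha>: "\<alpha> \<in> {0..\<infinity>}"
  shows "norm (gegenbauer n (1/2 - s) (of_real (tanh_ext \<alpha>))
        - Omega n \<tau> * exp_cosh_ext s \<alpha> * (D_plus n \<tau> + D_minus n \<tau> * exp_decay_ext s \<alpha>))
    \<le> norm (Omega n \<tau> * exp_cosh_ext s \<alpha>) * norm (\<tau> * (1 - \<tau>) / s) *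
      (2 * tanh_ext \<alpha> / (1 - norm (\<tau> * (1 - \<tau>) / s)) * (if even n then 1 else 1 / norm s))"
    (is "?L \<alpha> \<le> ?R \<alpha>")
proof -
  have finite: "?L (ereal a) \<le> ?R (ereal a)" if "a \<ge> 0" for a
  proof -
    let ?E = "exp_cosh_ext s (ereal a)"
    have "?L (ereal a) = norm ?E * norm (normalized_gegenbauer n s a
        - Omega n \<tau> * (D_plus n \<tau> + D_minus n \<tau> * exp (- 2 * s * of_real a)))"
      unfolding norm_mult[symmetric] gegenbauer_tanh_ext_eq exp_decay_ext_simps(1)
      by (rule arg_cong[where f = norm]) (simp only: right_diff_distrib mult_ac)
    also have "\<dots> \<le> norm ?E * (norm (Omega n \<tau>) * norm (\<tau> * (1 - \<tau>) / s) *
      (2 * tanh a / (1 - norm (\<tau> * (1 - \<tau>) / s)) * (if even n then 1 else 1 / norm s)))"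
      using normalized_gegenbauer_estimate[of \<tau> n a] pos s small that
      unfolding s_def by (intro mult_left_mono) simp_all
    also have "\<dots> = ?R (ereal a)"
      unfolding norm_mult tanh_ext_simps by (simp only: mult_ac)
    finally show ?thesis .
  qed
  show ?thesis
  proof (cases \<alpha>)
    case (real a)
    then show ?thesis using finite[of a] \<alpha> by simp
  next
    case PInf
    have T: "((\<lambda>a. tanh_ext (ereal a)) \<longlongrightarrow> tanh_ext \<infinity>) at_top"
      unfolding tanh_ext_simps by (rule tanh_real_at_top)
    have E: "((\<lambda>a. exp_cosh_ext s (ereal a)) \<longlongrightarrow> exp_cosh_ext s \<infinity>) at_top"
      unfolding exp_cosh_ext_simps by (rule exp_cosh_ext_tendsto)
    have D: "((\<lambda>a. exp_decay_ext s (ereal a)) \<longlongrightarrow> exp_decay_ext s \<infinity>) at_top"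
      unfolding exp_decay_ext_simps(1) exp_decay_ext_simps(2)[OF s] by (rule exp_decay_ext_tendsto[OF s])
    have "((\<lambda>a. ?L (ereal a)) \<longlongrightarrow> ?L \<infinity>) at_top"
      unfolding poly_gegenbauer_poly[symmetric]
      by (intro tendsto_intros T E D isCont_tendsto_compose[OF poly_isCont])
    moreover have "((\<lambda>a. ?R (ereal a)) \<longlongrightarrow> ?R \<infinity>) at_top"
      using small by (intro tendsto_intros T E) auto
    moreover have "\<forall>\<^sub>F a in at_top. ?L (ereal a) \<le> ?R (ereal a)"
      using eventually_ge_at_top[of 0] by eventually_elim (rule finite)
    ultimately have "?L \<infinity> \<le> ?R \<infinity>"
      by (intro tendsto_le[OF trivial_limit_at_top_linorder])
    then show ?thesis using PInf by simp
  next
    case MInf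
    then show ?thesis using \<alpha> by simp
  qed
qed

lemma Omega_nonzero:
  assumes "Re (1/2 + \<tau> + of_nat (n div 2)) > 0"
  shows "Omega n \<tau> \<noteq> 0"
proof -
  have pos: "Gamma z \<noteq> 0" if "Re z > 0" for z :: complex
    using Re_pos_not_nonpos_Int[OF that] by (simp add: Gamma_eq_zero_iff)
  have "Re (1/2 + \<tau> + of_nat (n div 2)) \<le> Re (1/2 + \<tau> + of_nat n)"
    by simp
  with assms have "Gamma (1/2 + \<tau> + of_nat n) \<noteq> 0"
    by (intro pos) linarith
  moreover have "Gamma (of_nat (n div 2) + 1 :: complex) \<noteq> 0"
    by (intro pos) simp
  ultimately show ?thesis
    using pos[OF assms] by (simp add: Omega_def)
qed

lemma large_index:
  fixes \<tau> :: complex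
  obtains N :: nat where "\<And>n. n \<ge> N \<Longrightarrow> Re (1/2 + \<tau> + of_nat (n div 2)) > 0"
    "\<And>n. n \<ge> N \<Longrightarrow> Re (of_nat n + \<tau>) > 0"
    "\<And>n. n \<ge> N \<Longrightarrow> norm (\<tau> * (1 - \<tau>) / (of_nat n + \<tau>)) < 1"
proof -
  \<comment> \<open>The first summand keeps both real parts positive; together they give \<open>\<bar>n + \<tau>\<bar> > \<bar>\<tau> (1 - \<tau>)\<bar>\<close>.\<close>
  obtain N :: nat where N: "real N > 2 * norm \<tau> + norm (\<tau> * (1 - \<tau>))"
    using reals_Archimedean2 by blast
  have \<tau>: "Re \<tau> \<ge> - norm \<tau>" using abs_Re_le_cmod[of \<tau>] by linarith
  show thesis
  proof (rule that[of N])
    fix n :: nat assume "n \<ge> N"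
    then have n: "real n > 2 * norm \<tau> + norm (\<tau> * (1 - \<tau>))" using N by linarith
    then have n': "real n > 2 * norm \<tau>" using norm_ge_zero[of "\<tau> * (1 - \<tau>)"] by linarith
    have "n \<le> 2 * (n div 2) + 1" by linarith
    then have "real n \<le> real (2 * (n div 2) + 1)" by (rule of_nat_mono)
    then show "Re (1/2 + \<tau> + of_nat (n div 2)) > 0" using \<tau> n' by simp
    show pos: "Re (of_nat n + \<tau>) > 0" using \<tau> n' norm_ge_zero[of \<tau>] by simp
    have "norm (of_nat n :: complex) - norm \<tau> \<le> norm (of_nat n + \<tau>)" by (rule norm_diff_ineq)
    then have "norm (\<tau> * (1 - \<tau>)) < norm (of_nat n + \<tau>)"
      using n norm_ge_zero[of \<tau>] unfolding norm_of_nat by linarith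
    then show "norm (\<tau> * (1 - \<tau>) / (of_nat n + \<tau>)) < 1"
      using pos by (auto simp: norm_divide divide_less_eq_1)
  qed
qed

text \<open>
  The remainder is obtained by solving the expansion for it, which needs \<open>c \<noteq> 0\<close>.  For \<open>c = 0\<close>,
  that is \<open>\<tau> = 0\<close> or \<open>\<tau> = 1\<close>, the estimate says that the expansion is exact, and \<open>0\<close> will do.
\<close>

lemma exists_remainder:
  fixes X Y W c :: complex
  assumes "norm (X - W * Y) \<le> norm W * norm c * b" "W \<noteq> 0" "b \<ge> 0"
  shows "\<exists>r. X = W * (Y + c * r) \<and> norm r \<le> b"
proof (cases "c = 0")
  case True
  then show ?thesis using assms by (intro exI[of _ 0]) auto
next
  case False
  with assms show ?thesis
    by (intro exI[of _ "(X - W * Y) / (W * c)"]) (auto simp: norm_divide norm_mult field_simps)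
qed

theorem theorem3:
  shows "\<exists>R :: nat \<Rightarrow> ereal \<Rightarrow> complex \<Rightarrow> complex. \<forall>\<tau> :: complex. \<exists>N :: nat. \<forall>n \<ge> N. \<forall>\<alpha> \<in> {0..\<infinity>}.
    gegenbauer n (1/2 - \<tau> - of_nat n) (of_real (tanh_ext \<alpha>)) =
      Omega n \<tau> * exp_cosh_ext (of_nat n + \<tau>) \<alpha> *
        (D_plus n \<tau> + D_minus n \<tau> * exp_decay_ext (of_nat n + \<tau>) \<alpha>
          + \<tau> * (1 - \<tau>) / (of_nat n + \<tau>) * R n \<alpha> \<tau>)
    \<and> norm (R n \<alpha> \<tau>) \<le>
        2 * tanh_ext \<alpha> / (1 - norm (\<tau> * (1 - \<tau>) / (of_nat n + \<tau>)))
          * (if even n then 1 else 1 / norm (of_nat n + \<tau>))"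
    (is "\<exists>R. \<forall>\<tau>. \<exists>N. \<forall>n \<ge> N. \<forall>\<alpha> \<in> _. ?P \<tau> n \<alpha> (R n \<alpha> \<tau>)")
proof (intro exI[of _ "\<lambda>n \<alpha> \<tau>. SOME r. ?P \<tau> n \<alpha> r"] allI)
  fix \<tau> :: complex
  obtain N :: nat where N: "\<And>n. n \<ge> N \<Longrightarrow> Re (1/2 + \<tau> + of_nat (n div 2)) > 0"
    "\<And>n. n \<ge> N \<Longrightarrow> Re (of_nat n + \<tau>) > 0"
    "\<And>n. n \<ge> N \<Longrightarrow> norm (\<tau> * (1 - \<tau>) / (of_nat n + \<tau>)) < 1"
    using large_index[of \<tau>] by blast
  show "\<exists>N. \<forall>n \<ge> N. \<forall>\<alpha> \<in> {0..\<infinity>}. ?P \<tau> n \<alpha> (SOME r. ?P \<tau> n \<alpha> r)"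
  proof (intro exI[of _ N] allI impI ballI)
    fix n \<alpha> assume n: "n \<ge> N" and \<alpha>: "\<alpha> \<in> {0..\<infinity>::ereal}"
    have l: "1/2 - \<tau> - of_nat n = 1/2 - (of_nat n + \<tau>)" by simp
    have "\<exists>r. ?P \<tau> n \<alpha> r"
    proof (rule exists_remainder)
      show "norm (gegenbauer n (1/2 - \<tau> - of_nat n) (of_real (tanh_ext \<alpha>))
          - Omega n \<tau> * exp_cosh_ext (of_nat n + \<tau>) \<alpha> *
            (D_plus n \<tau> + D_minus n \<tau> * exp_decay_ext (of_nat n + \<tau>) \<alpha>))
        \<le> norm (Omega n \<tau> * exp_cosh_ext (of_nat n + \<tau>) \<alpha>) * norm (\<tau> * (1 - \<tau>) / (of_nat n + \<tau>)) *
          (2 * tanh_ext \<alpha> / (1 - norm (\<tau> * (1 - \<tau>) / (of_nat n + \<tau>)))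
            * (if even n then 1 else 1 / norm (of_nat n + \<tau>)))"
        unfolding l by (rule gegenbauer_estimate_ext[OF N(1)[OF n] N(2)[OF n] N(3)[OF n] \<alpha>])
      show "Omega n \<tau> * exp_cosh_ext (of_nat n + \<tau>) \<alpha> \<noteq> 0"
        using Omega_nonzero[OF N(1)[OF n]] exp_cosh_ext_nonzero[of \<alpha>] \<alpha> by auto
      have "tanh_ext \<alpha> \<ge> 0"
        using \<alpha> by (cases \<alpha>) (auto simp: tanh_ext_simps)
      then show "0 \<le> 2 * tanh_ext \<alpha> / (1 - norm (\<tau> * (1 - \<tau>) / (of_nat n + \<tau>)))
            * (if even n then 1 else 1 / norm (of_nat n + \<tau>))"
        using N(3)[OF n] by auto
    qed
    then show "?P \<tau> n \<alpha> (SOME r. ?P \<tau> n \<alpha> r)" by (rule someI_ex)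
  qed
qed

end
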